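(* Let $\mu$ be a self-similar measure on $\mathbb{R}^d$ (with $R^{-1}=\lambda O$, $0<\lambda<1$, $O$ orthogonal) which is absolutely continuous with respect to Lebesgue measure restricted to its attractor $X$. If $\mu$ admits a frame measure, then $p_\tau\le\lambda^{dk}$ for all $k\in\mathbb{N}$ and all $\tau\in\mathcal{A}_k$. If moreover the fixed point condition holds for some $k\in\mathbb{N}$ and $\tau\in\mathcal{A}_k$, then for this $k$ and $\tau$, $p_\tau=\lambda^{dk}$.
   Context: IFS $\tau_{b_i}(x)=R^{-1}(x+b_i)$, $i=1,\dots,N$, $b_i\in\mathbb{R}^d$, weights $p_{b_i}>0$ summing to $1$; attractor $X=\bigcup_i\tau_{b_i}(X)$; invariant (self-similar) measure $\mu=\sum_ip_{b_i}\mu\circ\tau_{b_i}^{-1}$. For $I=i_1\cdots i_n$, $\tau_I=\tau_{b_{i_1}}\circ\cdots\circ\tau_{b_{i_n}}$, $p_I=\prod_j p_{b_{i_j}}$; $\mathcal{A}_n$ is the set of distinct maps among $\{\tau_I: |I|=n\}$, and $p_\tau=\sum\{p_I:\tau_I=\tau\}$. Fixed point condition for $k$ and $\tau\in\mathcal{A}_k$: the fixed point $x_\tau$ of $\tau$ does not lie in $\tilde\tau(X)$ for any $\tilde\tau\in\mathcal{A}_k$, $\tilde\tau\ne\tau$. A frame measure for $\mu$ is a Borel measure $\nu$ with $A\|f\|_{L^2(\mu)}^2\le\|\widehat{f\,d\mu}\|_{L^2(\nu)}^2\le B\|f\|_{L^2(\mu)}^2$ for all $f\in L^2(\mu)$,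 some $A,B>0$, where $\widehat{f\,d\mu}(t)=\int f(x)e^{-2\pi it\cdot x}d\mu(x)$. *)

theory Defs
  imports "HOL-Probability.Probability"
begin

text \<open>IFS maps tau_b(x) = R^{-1}(x + b) with R^{-1} = lam * Orth, Orth orthogonal.\<close>
definition ifs_map :: "real \<Rightarrow> ('a::euclidean_space \<Rightarrow> 'a) \<Rightarrow> 'a \<Rightarrow> 'a \<Rightarrow> 'a" where
  "ifs_map lam Orth b x = lam *\<^sub>R Orth (x + b)"

definition words :: "nat \<Rightarrow> nat \<Rightarrow> nat list set" where
  "words N n = {I. length I = n \<and> set I \<subseteq> {..<N}}"

definition word_map :: "real \<Rightarrow> ('a::euclidean_space \<Rightarrow> 'a) \<Rightarrow> (nat \<Rightarrow> 'a) \<Rightarrow> nat list \<Rightarrow> 'a \<Rightarrow> 'a" where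
  "word_map lam Orth b I = foldr (\<lambda>i f. ifs_map lam Orth (b i) \<circ> f) I id"

definition word_weight :: "(nat \<Rightarrow> real) \<Rightarrow> nat list \<Rightarrow> real" where
  "word_weight p I = prod_list (map p I)"

definition maps_A :: "real \<Rightarrow> ('a::euclidean_space \<Rightarrow> 'a) \<Rightarrow> (nat \<Rightarrow> 'a) \<Rightarrow> nat \<Rightarrow> nat \<Rightarrow> ('a \<Rightarrow> 'a) set" where
  "maps_A lam Orth b N n = word_map lam Orth b ` words N n"

definition weight_A :: "real \<Rightarrow> ('a::euclidean_space \<Rightarrow> 'a) \<Rightarrow> (nat \<Rightarrow> 'a) \<Rightarrow> (nat \<Rightarrow> real) \<Rightarrow> nat \<Rightarrow> nat \<Rightarrow> ('a \<Rightarrow> 'a) \<Rightarrow> real" where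
  "weight_A lam Orth b p N n \<tau> = (\<Sum>I\<in>{I \<in> words N n. word_map lam Orth b I = \<tau>}. word_weight p I)"

definition fixed_point_condition :: "real \<Rightarrow> ('a::euclidean_space \<Rightarrow> 'a) \<Rightarrow> (nat \<Rightarrow> 'a) \<Rightarrow> nat \<Rightarrow> 'a set \<Rightarrow> nat \<Rightarrow> ('a \<Rightarrow> 'a) \<Rightarrow> bool" where
  "fixed_point_condition lam Orth b N X k \<tau> \<longleftrightarrow>
     (\<forall>\<tau>'\<in>maps_A lam Orth b N k. \<tau>' \<noteq> \<tau> \<longrightarrow> (THE x. \<tau> x = x) \<notin> \<tau>' ` X)"

definition fourier_fmu :: "'a::euclidean_space measure \<Rightarrow> ('a \<Rightarrow> complex) \<Rightarrow> 'a \<Rightarrow> complex" where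
  "fourier_fmu \<mu> f t = (LINT x|\<mu>. f x * cis (- 2 * pi * (t \<bullet> x)))"

definition frame_measure :: "'a::euclidean_space measure \<Rightarrow> 'a measure \<Rightarrow> bool" where
  "frame_measure \<mu> \<nu> \<longleftrightarrow> sets \<nu> = sets borel \<and>
     (\<exists>A B. 0 < A \<and> 0 < B \<and>
       (\<forall>f::'a \<Rightarrow> complex. f \<in> borel_measurable \<mu> \<and> integrable \<mu> (\<lambda>x. (cmod (f x))\<^sup>2) \<longrightarrow>
          ennreal (A * (\<integral>x. (cmod (f x))\<^sup>2 \<partial>\<mu>)) \<le> (\<integral>\<^sup>+ t. ennreal ((cmod (fourier_fmu \<mu> f t))\<^sup>2) \<partial>\<nu>) \<and>
          (\<integral>\<^sup>+ t. ennreal ((cmod (fourier_fmu \<mu> f t))\<^sup>2) \<partial>\<nu>) \<le> ennreal (B * (\<integral>x. (cmod (f x))\<^sup>2 \<partial>\<mu>))))"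

end

theory Submission
  imports Defs
begin

text \<open>
  Let \<open>h\<close> be the Lebesgue density of \<open>\<mu>\<close>. If \<open>S\<close> and its translate \<open>S + a\<close> both lie in \<open>{h > 0}\<close>,
  the functions \<open>indicator S / h\<close> and \<open>indicator (S + a) / h\<close> have Fourier transforms of equal
  modulus, so the frame inequalities bound the ratio of their norms. Since any two sets of positive
  measure overlap after a translation, \<open>h\<close> is bounded above, and bounded away from 0 on \<open>{h > 0}\<close>.

  For \<open>\<tau>\<close> of level \<open>k\<close> with weight \<open>w\<close>, invariance gives \<open>\<mu> (\<tau>^n X) \<ge> w^n\<close>, whereas
  \<open>\<tau>^n X\<close> has Lebesgue measure of order \<open>lam^(d k n)\<close>; the upper bound on \<open>h\<close> yields
  \<open>w \<le> lam^(d k)\<close>. Under the fixed point condition a small ball \<open>U\<close> around the fixed point misses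
  all other cylinders of level \<open>k\<close>, so \<open>\<mu> (\<tau>^n E) = w^n \<mu> E\<close> for \<open>E\<close> inside \<open>U\<close>. Taking
  \<open>E = {h > 0} \<inter> U\<close>, which \<open>\<tau>^n\<close> maps into \<open>{h > 0}\<close> up to a null set, the lower bound on \<open>h\<close>
  yields the reverse inequality.
\<close>

section \<open>Lebesgue measure under similarities\<close>

lemma nn_integral_lborel_plus:
  fixes a :: "'a::euclidean_space"
  assumes [measurable]: "g \<in> borel_measurable borel"
  shows "(\<integral>\<^sup>+x. g (a + x) \<partial>lborel) = (\<integral>\<^sup>+x. g x \<partial>lborel)"
proof -
  have "(\<integral>\<^sup>+x. g x \<partial>lborel) = (\<integral>\<^sup>+x. g x \<partial>distr lborel borel ((+) a))"
    by (simp add: lborel_distr_plus)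
  also have "\<dots> = (\<integral>\<^sup>+x. g (a + x) \<partial>lborel)"
    by (subst nn_integral_distr) auto
  finally show ?thesis by simp
qed

lemma integral_lborel_plus:
  fixes a :: "'a::euclidean_space" and g :: "'a \<Rightarrow> 'b::{banach, second_countable_topology}"
  assumes [measurable]: "g \<in> borel_measurable borel"
  shows "(\<integral>x. g (a + x) \<partial>lborel) = (\<integral>x. g x \<partial>lborel)"
proof -
  have "(\<integral>x. g x \<partial>lborel) = (\<integral>x. g x \<partial>distr lborel borel ((+) a))"
    by (simp add: lborel_distr_plus)
  also have "\<dots> = (\<integral>x. g (a + x) \<partial>lborel)"
    by (subst integral_distr) auto
  finally show ?thesis by simp
qed

lemma emeasure_lborel_ball_eq:
  fixes c :: "'a::euclidean_space"
  assumes "0 \<le> r"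
  shows "emeasure lborel (ball c r) = ennreal (r ^ DIM('a)) * emeasure lborel (ball (0::'a) 1)"
  using assms by (simp add: emeasure_ball ennreal_mult' mult.commute)

text \<open>By Fubini, integrating over all \<open>a\<close> the volume of \<open>S\<close>
  intersected with the translate of \<open>T\<close> by \<open>-a\<close> gives the product of the
  two volumes, so the overlap cannot be null for every \<open>a\<close>.\<close>

lemma exists_translate_overlap:
  fixes S T :: "'a::euclidean_space set"
  assumes [measurable]: "S \<in> sets borel" "T \<in> sets borel"
    and pos: "emeasure lborel S \<noteq> 0" "emeasure lborel T \<noteq> 0"
  obtains a where "emeasure lborel (S \<inter> (\<lambda>x. a + x) -` T) \<noteq> 0"
proof (rule ccontr)
  assume "\<not> thesis"
  with that have 0: "emeasure lborel (S \<inter> (\<lambda>x. a + x) -` T) = 0" for a by blast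
  have "0 = (\<integral>\<^sup>+a. emeasure lborel (S \<inter> (\<lambda>x. a + x) -` T) \<partial>(lborel::'a measure))"
    by (simp add: 0)
  also have "\<dots> = (\<integral>\<^sup>+a. (\<integral>\<^sup>+x. indicator S x * indicator T (x + a) \<partial>lborel) \<partial>lborel)"
  proof (rule nn_integral_cong)
    fix a :: 'a
    have "emeasure lborel (S \<inter> (\<lambda>x. a + x) -` T) = (\<integral>\<^sup>+x. indicator (S \<inter> (\<lambda>x. a + x) -` T) x \<partial>lborel)"
      by (subst nn_integral_indicator) (auto intro!: sets.Int measurable_sets_borel[of _ borel])
    also have "\<dots> = (\<integral>\<^sup>+x. indicator S x * indicator T (x + a) \<partial>lborel)"
      by (intro nn_integral_cong) (auto simp: indicator_def add.commute)
    finally show "emeasure lborel (S \<inter> (\<lambda>x. a + x) -` T) = \<dots>" .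
  qed
  also have "\<dots> = (\<integral>\<^sup>+x. (\<integral>\<^sup>+a. indicator S x * indicator T (x + a) \<partial>lborel) \<partial>lborel)"
    by (rule lborel_pair.Fubini') measurable
  also have "\<dots> = (\<integral>\<^sup>+x. indicator S x * emeasure lborel T \<partial>lborel)"
    by (intro nn_integral_cong) (simp add: nn_integral_cmult nn_integral_lborel_plus[of "indicator T"])
  also have "\<dots> = emeasure lborel S * emeasure lborel T"
    by (simp add: nn_integral_multc)
  finally show False using pos by simp
qed

text \<open>Removing \<open>f 0\<close> and the factor \<open>r\<close> leaves an isometry fixing
  the origin, and such a map is orthogonal. Its linearity allows translations to be moved through
  \<open>f\<close>.\<close>

lemma similarity_affine:
  fixes f :: "'a::euclidean_space \<Rightarrow> 'a"
  assumes r: "0 < r" and f: "\<And>x y. dist (f x) (f y) = r * dist x y"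
  obtains g where "orthogonal_transformation g" "f = (\<lambda>x. f 0 + r *\<^sub>R g x)"
proof
  define g where "g x = (1 / r) *\<^sub>R (f x - f 0)" for x
  have "dist (g x) (g y) = dist x y" for x y
  proof -
    have "g x - g y = (1 / r) *\<^sub>R (f x - f y)"
      by (simp add: g_def algebra_simps)
    then show ?thesis
      using r f[of x y] by (simp add: dist_norm)
  qed
  then show "orthogonal_transformation g"
    by (simp add: orthogonal_transformation_isometry g_def)
  show "f = (\<lambda>x. f 0 + r *\<^sub>R g x)"
    using r by (simp add: g_def fun_eq_iff)
qed

lemma similarity_bij:
  fixes f :: "'a::euclidean_space \<Rightarrow> 'a"
  assumes r: "0 < r" and f: "\<And>x y. dist (f x) (f y) = r * dist x y"
  shows "bij f"
proof (rule bijI)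
  show "inj f"
    using r f by (metis (no_types) dist_eq_0_iff injI mult_eq_0_iff less_irrefl)
  obtain g where g: "orthogonal_transformation g" "f = (\<lambda>x. f 0 + r *\<^sub>R g x)"
    using similarity_affine[OF r f] by metis
  show "surj f"
  proof (rule surjI)
    fix y
    have "g (inv g ((1 / r) *\<^sub>R (y - f 0))) = (1 / r) *\<^sub>R (y - f 0)"
      by (rule surj_f_inv_f[OF orthogonal_transformation_surj[OF g(1)]])
    then show "f (inv g ((1 / r) *\<^sub>R (y - f 0))) = y"
      using r by (subst g(2)) simp
  qed
qed

lemma similarity_measurable:
  fixes f :: "'a::euclidean_space \<Rightarrow> 'a"
  assumes r: "0 < r" and f: "\<And>x y. dist (f x) (f y) = r * dist x y"
  shows "f \<in> borel_measurable borel"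
proof -
  have "continuous_on UNIV f"
    by (rule lipschitz_on_continuous_on[of r]) (use r f in \<open>auto simp: lipschitz_on_def\<close>)
  then show ?thesis by (rule borel_measurable_continuous_onI)
qed

lemma similarity_inv:
  fixes f :: "'a::euclidean_space \<Rightarrow> 'a"
  assumes r: "0 < r" and f: "\<And>x y. dist (f x) (f y) = r * dist x y"
  shows "dist (inv f x) (inv f y) = (1 / r) * dist x y"
proof -
  have "f (inv f z) = z" for z
    using similarity_bij[OF r f] by (simp add: bij_is_surj surj_f_inv_f)
  then show ?thesis
    using f[of "inv f x" "inv f y"] r by simp
qed

lemma similarity_image_borel:
  fixes f :: "'a::euclidean_space \<Rightarrow> 'a"
  assumes r: "0 < r" and f: "\<And>x y. dist (f x) (f y) = r * dist x y" and E: "E \<in> sets borel"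
  shows "f ` E \<in> sets borel"
proof -
  have "inv f \<in> borel_measurable borel"
    by (rule similarity_measurable[of "1 / r"]) (use r similarity_inv[OF r f] in auto)
  from measurable_sets_borel[OF this E] show ?thesis
    using bij_vimage_eq_inv_image[OF bij_imp_bij_inv[OF similarity_bij[OF r f]]]
    by (simp add: inv_inv_eq similarity_bij[OF r f])
qed

lemma similarity_vimage_ball:
  fixes f :: "'a::euclidean_space \<Rightarrow> 'a"
  assumes r: "0 < r" and f: "\<And>x y. dist (f x) (f y) = r * dist x y"
  shows "f -` ball y 1 = ball (inv f y) (1 / r)"
proof -
  have "f (inv f y) = y"
    using similarity_bij[OF r f] by (simp add: bij_is_surj surj_f_inv_f)
  then have "dist y (f x) = r * dist (inv f y) x" for x
    using f[of "inv f y" x] by simp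
  then show ?thesis
    using r by (auto simp: field_simps)
qed

text \<open>Both sides are evaluations of the double integral of
  \<open>indicator E (f x + y) * indicator (ball 0 1) y\<close>, in the two orders.\<close>
lemma emeasure_lborel_similarity_vimage:
  fixes f :: "'a::euclidean_space \<Rightarrow> 'a"
  assumes r: "0 < r" and f: "\<And>x y. dist (f x) (f y) = r * dist x y" and E[measurable]: "E \<in> sets borel"
  shows "emeasure lborel (f -` E) = ennreal ((1 / r) ^ DIM('a)) * emeasure lborel E"
proof -
  let ?B = "ball (0::'a) 1"
  have [measurable]: "f \<in> borel_measurable borel" by (rule similarity_measurable[OF r f])
  have [measurable]: "?B \<in> sets borel" by simp
  obtain g where g: "orthogonal_transformation g" "f = (\<lambda>x. f 0 + r *\<^sub>R g x)"
    using similarity_affine[OF r f] by metis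
  \<comment> \<open>Adding \<open>y\<close> after \<open>f\<close> amounts to translating the
    argument by the \<open>g\<close>-preimage of \<open>y / r\<close>, so the inner integral does
    not depend on \<open>y\<close>.\<close>
  have trans: "(\<integral>\<^sup>+x. indicator E (f x + y) \<partial>lborel) = emeasure lborel (f -` E)" for y
  proof -
    define u where "u = inv g ((1 / r) *\<^sub>R y)"
    have gu: "g u = (1 / r) *\<^sub>R y"
      unfolding u_def by (rule surj_f_inv_f[OF orthogonal_transformation_surj[OF g(1)]])
    have "f (u + x) = f x + y" for x
    proof -
      have "f (u + x) = f 0 + r *\<^sub>R g (u + x)" by (subst g(2)) simp
      also have "\<dots> = f 0 + r *\<^sub>R g x + y"
        using r by (simp add: orthogonal_transformation_linear[OF g(1)] linear_add gu algebra_simps)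
      also have "f 0 + r *\<^sub>R g x = f x" by (subst (2) g(2)) simp
      finally show ?thesis .
    qed
    then have "(\<integral>\<^sup>+x. indicator E (f x + y) \<partial>lborel) = (\<integral>\<^sup>+x. indicator E (f (u + x)) \<partial>lborel)"
      by simp
    also have "\<dots> = (\<integral>\<^sup>+x. indicator E (f x) \<partial>lborel)"
      by (rule nn_integral_lborel_plus[of "\<lambda>x. indicator E (f x)"]) measurable
    also have "\<dots> = (\<integral>\<^sup>+x. indicator (f -` E) x \<partial>lborel)"
      by (simp add: indicator_def)
    also have "\<dots> = emeasure lborel (f -` E)"
      by (subst nn_integral_indicator) (auto intro!: measurable_sets_borel[of _ borel])
    finally show ?thesis .
  qed
  have "emeasure lborel ?B * emeasure lborel (f -` E)
      = (\<integral>\<^sup>+y. (\<integral>\<^sup>+x. indicator ?B y * indicator E (f x + y) \<partial>lborel) \<partial>lborel)"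
    by (simp add: nn_integral_cmult trans nn_integral_multc)
  also have "\<dots> = (\<integral>\<^sup>+x. (\<integral>\<^sup>+y. indicator ?B y * indicator E (f x + y) \<partial>lborel) \<partial>lborel)"
    by (rule lborel_pair.Fubini') measurable
  also have "\<dots> = (\<integral>\<^sup>+x. (\<integral>\<^sup>+y. indicator ?B (y - f x) * indicator E y \<partial>lborel) \<partial>lborel)"
  proof (rule nn_integral_cong)
    fix x
    show "(\<integral>\<^sup>+y. indicator ?B y * indicator E (f x + y) \<partial>lborel)
        = (\<integral>\<^sup>+y. indicator ?B (y - f x) * indicator E y \<partial>lborel)"
      by (subst nn_integral_lborel_plus[of "\<lambda>y. indicator ?B (y - f x) * indicator E y" "f x", symmetric])
        simp_all
  qed
  also have "\<dots> = (\<integral>\<^sup>+y. (\<integral>\<^sup>+x. indicator ?B (y - f x) * indicator E y \<partial>lborel) \<partial>lborel)"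
    by (rule lborel_pair.Fubini'[symmetric]) measurable
  \<comment> \<open>In the other order, the admissible \<open>x\<close> for a given \<open>y\<close>
    form the preimage of the unit ball around \<open>y\<close>. This is a ball of radius
    \<open>1 / r\<close>, whose volume is known.\<close>
  also have "\<dots> = (\<integral>\<^sup>+y. (ennreal ((1 / r) ^ DIM('a)) * emeasure lborel ?B) * indicator E y \<partial>lborel)"
  proof (rule nn_integral_cong)
    fix y
    have "(\<integral>\<^sup>+x. indicator ?B (y - f x) \<partial>lborel) = (\<integral>\<^sup>+x. indicator (ball (inv f y) (1 / r)) x \<partial>lborel)"
      by (rule nn_integral_cong, subst similarity_vimage_ball[OF r f, symmetric])
         (simp add: indicator_def dist_norm norm_minus_commute)
    also have "\<dots> = emeasure lborel (ball (inv f y) (1 / r))"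
      by simp
    also have "\<dots> = ennreal ((1 / r) ^ DIM('a)) * emeasure lborel ?B"
      using r by (intro emeasure_lborel_ball_eq) simp
    finally show "(\<integral>\<^sup>+x. indicator ?B (y - f x) * indicator E y \<partial>lborel)
      = (ennreal ((1 / r) ^ DIM('a)) * emeasure lborel ?B) * indicator E y"
      by (simp add: nn_integral_multc)
  qed
  also have "\<dots> = emeasure lborel ?B * (ennreal ((1 / r) ^ DIM('a)) * emeasure lborel E)"
    by (subst nn_integral_cmult_indicator) (auto simp: mult_ac)
  finally show ?thesis
    using less_imp_neq[OF unit_ball_vol_pos[OF of_nat_0_le_iff[of "DIM('a)"]]]
    by (subst (asm) ennreal_mult_cancel_left) (auto simp: emeasure_ball)
qed

lemma emeasure_lborel_similarity_image:
  fixes f :: "'a::euclidean_space \<Rightarrow> 'a"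
  assumes r: "0 < r" and f: "\<And>x y. dist (f x) (f y) = r * dist x y" and E: "E \<in> sets borel"
  shows "emeasure lborel (f ` E) = ennreal (r ^ DIM('a)) * emeasure lborel E"
proof -
  have "f -` (f ` E) = E"
    by (rule inj_vimage_image_eq[OF bij_is_inj[OF similarity_bij[OF r f]]])
  with emeasure_lborel_similarity_vimage[OF r f similarity_image_borel[OF r f E]]
  have "emeasure lborel E = ennreal ((1 / r) ^ DIM('a)) * emeasure lborel (f ` E)" by simp
  then have "ennreal (r ^ DIM('a)) * emeasure lborel E
      = ennreal (r ^ DIM('a) * (1 / r) ^ DIM('a)) * emeasure lborel (f ` E)"
    using r by (simp add: ennreal_mult mult.assoc)
  also have "r ^ DIM('a) * (1 / r) ^ DIM('a) = 1"
    using r by (simp add: power_one_over)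
  finally show ?thesis by simp
qed

section \<open>Densities of measures with a frame measure\<close>

text \<open>Dividing by \<open>h\<close> cancels the density: \<open>f\<close> times
  \<open>\<mu>\<close> is Lebesgue measure on \<open>S\<close>. The transform then depends on
  \<open>S\<close> alone, while the squared norm still sees \<open>1 / h\<close>. The lower bound
  \<open>e\<close> keeps \<open>f\<close> square integrable.\<close>

lemma frame_test_function:
  fixes h :: "'a::euclidean_space \<Rightarrow> real"
  assumes h[measurable]: "h \<in> borel_measurable borel" and h0: "\<And>x. 0 \<le> h x"
    and S[measurable]: "S \<in> sets borel" and fin: "emeasure lborel S < \<infinity>"
    and e: "0 < e" "\<forall>x\<in>S. e \<le> h x"
  defines "f \<equiv> \<lambda>x. complex_of_real (indicator S x / h x)"
    and "\<mu> \<equiv> density lborel (\<lambda>x. ennreal (h x))"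
  shows frame_test_measurable: "f \<in> borel_measurable \<mu>"
    and frame_test_integrable_lborel: "integrable lborel (\<lambda>x. indicator S x / h x)"
    and frame_test_integrable: "integrable \<mu> (\<lambda>x. (cmod (f x))\<^sup>2)"
    and frame_test_norm: "(\<integral>x. (cmod (f x))\<^sup>2 \<partial>\<mu>) = (\<integral>x. indicator S x / h x \<partial>lborel)"
    and frame_test_fourier:
      "fourier_fmu \<mu> f t = (\<integral>x. indicator S x *\<^sub>R cis (- 2 * pi * (t \<bullet> x)) \<partial>lborel)"
proof -
  show f: "f \<in> borel_measurable \<mu>"
    unfolding f_def \<mu>_def by simp
  have f': "f \<in> borel_measurable lborel"
    unfolding f_def by simp
  have "integrable lborel (\<lambda>x. (1 / e) *\<^sub>R indicator S x :: real)"
    using fin by (intro integrable_scaleR_right integrable_real_indicator) auto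
  then show int: "integrable lborel (\<lambda>x. indicator S x / h x)"
  proof (rule Bochner_Integration.integrable_bound)
    show "AE x in lborel. norm (indicator S x / h x) \<le> norm ((1 / e) *\<^sub>R indicator S x :: real)"
      using e h0 by (auto simp: indicator_def frac_le)
  qed simp
  have sq: "h x *\<^sub>R (cmod (f x))\<^sup>2 = indicator S x / h x" for x
    using e h0[of x]
    by (auto simp: f_def indicator_def norm_divide power2_eq_square)
  show "integrable \<mu> (\<lambda>x. (cmod (f x))\<^sup>2)"
    unfolding \<mu>_def using f' h0 int by (subst integrable_density) (auto simp: sq[simplified])
  show "(\<integral>x. (cmod (f x))\<^sup>2 \<partial>\<mu>) = (\<integral>x. indicator S x / h x \<partial>lborel)"
    unfolding \<mu>_def using f' h0 by (subst integral_density) (auto simp: sq[simplified])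
  have m: "(\<lambda>x. f x * cis (- 2 * pi * (t \<bullet> x))) \<in> borel_measurable lborel"
    using f' by (simp add: cis_conv_exp)
  have "h x *\<^sub>R (f x * cis (- 2 * pi * (t \<bullet> x))) = indicator S x *\<^sub>R cis (- 2 * pi * (t \<bullet> x))" for x
    using e by (auto simp: f_def indicator_def scaleR_conv_of_real)
  then show "fourier_fmu \<mu> f t = (\<integral>x. indicator S x *\<^sub>R cis (- 2 * pi * (t \<bullet> x)) \<partial>lborel)"
    unfolding fourier_fmu_def \<mu>_def using h0 by (subst integral_density[OF m]) auto
qed

text \<open>Substituting \<open>a + x\<close> for \<open>x\<close> pulls out the factor
  \<open>cis (- 2 * pi * (t \<bullet> a))\<close>, which has modulus 1.\<close>

lemma cmod_fourier_translate:
  fixes S :: "'a::euclidean_space set"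
  assumes [measurable]: "S \<in> sets borel"
  shows "cmod (\<integral>x. indicator ((\<lambda>x. x - a) -` S) x *\<^sub>R cis (- 2 * pi * (t \<bullet> x)) \<partial>lborel)
       = cmod (\<integral>x. indicator S x *\<^sub>R cis (- 2 * pi * (t \<bullet> x)) \<partial>lborel)"
proof -
  let ?g = "\<lambda>x. indicator ((\<lambda>x. x - a) -` S) x *\<^sub>R cis (- 2 * pi * (t \<bullet> x))"
  have [measurable]: "(\<lambda>x. x - a) -` S \<in> sets borel"
    by (rule measurable_sets_borel[of _ borel]) auto
  have "?g \<in> borel_measurable borel"
    by (simp add: cis_conv_exp)
  then have "(\<integral>x. ?g x \<partial>lborel) = (\<integral>x. ?g (a + x) \<partial>lborel)"
    by (rule integral_lborel_plus[symmetric])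
  also have "\<dots> = (\<integral>x. cis (- 2 * pi * (t \<bullet> a)) * (indicator S x *\<^sub>R cis (- 2 * pi * (t \<bullet> x))) \<partial>lborel)"
    by (intro Bochner_Integration.integral_cong)
       (auto simp: indicator_def cis_mult inner_add_right algebra_simps)
  also have "\<dots> = cis (- 2 * pi * (t \<bullet> a)) * (\<integral>x. indicator S x *\<^sub>R cis (- 2 * pi * (t \<bullet> x)) \<partial>lborel)"
    by (rule integral_mult_right_zero)
  finally show ?thesis by (simp add: norm_mult)
qed

text \<open>Dividing the indicators of a set and of its translate by the density gives two functions
  whose Fourier transforms agree in modulus, so the frame inequalities compare their norms.\<close>
lemma frame_density_ratio:
  fixes h :: "'a::euclidean_space \<Rightarrow> real" and A B :: real
  defines "\<mu> \<equiv> density lborel (\<lambda>x. ennreal (h x))"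
  assumes h[measurable]: "h \<in> borel_measurable borel" and h0: "\<And>x. 0 \<le> h x"
    and fin: "finite_measure \<mu>"
    and AB: "0 < A" "0 < B"
    and lo: "\<And>f. f \<in> borel_measurable \<mu> \<Longrightarrow> integrable \<mu> (\<lambda>x. (cmod (f x))\<^sup>2) \<Longrightarrow>
      ennreal (A * (\<integral>x. (cmod (f x))\<^sup>2 \<partial>\<mu>)) \<le> (\<integral>\<^sup>+ t. ennreal ((cmod (fourier_fmu \<mu> f t))\<^sup>2) \<partial>\<nu>)"
    and hi: "\<And>f. f \<in> borel_measurable \<mu> \<Longrightarrow> integrable \<mu> (\<lambda>x. (cmod (f x))\<^sup>2) \<Longrightarrow>
      (\<integral>\<^sup>+ t. ennreal ((cmod (fourier_fmu \<mu> f t))\<^sup>2) \<partial>\<nu>) \<le> ennreal (B * (\<integral>x. (cmod (f x))\<^sup>2 \<partial>\<mu>))"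
    and e: "0 < e" "0 < \<beta>"
    and E1: "emeasure lborel {x. e \<le> h x \<and> h x \<le> \<alpha>} \<noteq> 0"
    and E2: "emeasure lborel {x. \<beta> \<le> h x} \<noteq> 0"
  shows "A * \<beta> \<le> B * \<alpha>"
proof -
  interpret finite_measure \<mu> by fact
  define E1 where "E1 = {x. e \<le> h x \<and> h x \<le> \<alpha>}"
  define E2 where "E2 = {x. \<beta> \<le> h x}"
  have [measurable]: "E1 \<in> sets borel" "E2 \<in> sets borel"
    unfolding E1_def E2_def by measurable
  \<comment> \<open>This translation carries a set of positive volume, on which \<open>h\<close> is
    at most \<open>\<alpha>\<close>, into the region where \<open>h\<close> is at least
    \<open>\<beta>\<close>. That set is \<open>S\<close> below, and \<open>T\<close> is its
    translate.\<close>
  obtain a where a: "emeasure lborel (E1 \<inter> (\<lambda>x. a + x) -` E2) \<noteq> 0"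
    using exists_translate_overlap[of E1 E2] assms unfolding E1_def E2_def by auto
  define S where "S = E1 \<inter> (\<lambda>x. a + x) -` E2"
  define T where "T = (\<lambda>x. x - a) -` S"
  have S[measurable]: "S \<in> sets borel"
    unfolding S_def by (intro sets.Int measurable_sets_borel[of _ borel]) auto
  have T[measurable]: "T \<in> sets borel"
    unfolding T_def by (rule measurable_sets_borel[of _ borel]) auto
  have TS: "indicator T (a + x) = (indicator S x :: 'b::zero_neq_one)" for x
    by (simp add: T_def indicator_def)
  have Se: "\<forall>x\<in>S. e \<le> h x" and Sh: "x \<in> S \<Longrightarrow> e \<le> h x" "x \<in> S \<Longrightarrow> h x \<le> \<alpha>" "x \<in> S \<Longrightarrow> \<beta> \<le> h (a + x)" for x
    by (auto simp: S_def E1_def E2_def)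
  have Th: "\<forall>x\<in>T. \<beta> \<le> h x"
    using Sh(3)[of "_ - a"] by (auto simp: T_def)
  \<comment> \<open>Since \<open>h\<close> is at least \<open>e\<close> on \<open>S\<close> and
    \<open>\<mu>\<close> is finite, \<open>S\<close> has finite volume, and so has its translate
    \<open>T\<close>.\<close>
  have "ennreal e * emeasure lborel S = (\<integral>\<^sup>+x. ennreal e * indicator S x \<partial>lborel)"
    by (simp add: nn_integral_cmult)
  also have "\<dots> \<le> (\<integral>\<^sup>+x. ennreal (h x) * indicator S x \<partial>lborel)"
    using Sh by (intro nn_integral_mono) (auto simp: indicator_def intro!: ennreal_leI)
  also have "\<dots> = emeasure \<mu> S"
    unfolding \<mu>_def by (simp add: emeasure_density)
  also have "\<dots> < \<infinity>"
    using emeasure_finite[of S] by (simp add: less_top[symmetric])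
  finally have Sfin: "emeasure lborel S < \<infinity>"
    using e by (auto simp: ennreal_mult_less_top)
  have "emeasure lborel T = (\<integral>\<^sup>+x. indicator T (a + x) \<partial>lborel)"
    by (subst nn_integral_lborel_plus) auto
  also have "\<dots> = emeasure lborel S" by (simp add: TS)
  finally have Tfin: "emeasure lborel T < \<infinity>" using Sfin by simp
  define f where "f x = complex_of_real (indicator S x / h x)" for x
  define g where "g x = complex_of_real (indicator T x / h x)" for x
  note fS = frame_test_function[OF h h0 S Sfin e(1) Se, folded \<mu>_def f_def]
  note gT = frame_test_function[OF h h0 T Tfin e(2) Th, folded \<mu>_def g_def]
  have four: "cmod (fourier_fmu \<mu> g t) = cmod (fourier_fmu \<mu> f t)" for t
    unfolding fS(5) gT(5) unfolding T_def by (rule cmod_fourier_translate[OF S])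
  \<comment> \<open>The lower frame inequality for \<open>f\<close> is chained with the upper one
    for \<open>g\<close>; the integrals over \<open>\<nu>\<close> in the middle coincide.\<close>
  have "ennreal (A * (\<integral>x. (cmod (f x))\<^sup>2 \<partial>\<mu>)) \<le> ennreal (B * (\<integral>x. (cmod (g x))\<^sup>2 \<partial>\<mu>))"
    using order_trans[OF lo[OF fS(1,3)] hi[OF gT(1,3), unfolded four]] .
  moreover have "0 \<le> B * (\<integral>x. (cmod (g x))\<^sup>2 \<partial>\<mu>)"
    using AB by simp
  ultimately have "A * (\<integral>x. (cmod (f x))\<^sup>2 \<partial>\<mu>) \<le> B * (\<integral>x. (cmod (g x))\<^sup>2 \<partial>\<mu>)"
    by (simp add: ennreal_le_iff)
  then have le: "A * (\<integral>x. indicator S x / h x \<partial>lborel) \<le> B * (\<integral>x. indicator T x / h x \<partial>lborel)"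
    by (simp add: fS(4) gT(4))
  define s where "s = measure lborel S"
  have s: "0 < s"
    using a Sfin unfolding s_def S_def[symmetric]
    by (simp add: measure_def enn2real_positive_iff zero_less_iff_neq_zero)
  obtain x0 where "x0 \<in> S" using a unfolding S_def[symmetric] by force
  then have \<alpha>: "0 < \<alpha>" using Sh e(1) by force
  have iS: "integrable lborel (indicator S :: 'a \<Rightarrow> real)"
    using Sfin by (intro integrable_real_indicator) auto
  \<comment> \<open>The bounds on \<open>h\<close> now replace both norms by volumes: at least
    \<open>s / \<alpha>\<close> for \<open>f\<close>, at most \<open>s / \<beta>\<close> for
    \<open>g\<close>. The common volume \<open>s\<close> cancels at the end.\<close>
  have "s / \<alpha> = (\<integral>x. indicator S x / \<alpha> \<partial>lborel)"
    by (simp add: s_def)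
  also have "\<dots> \<le> (\<integral>x. indicator S x / h x \<partial>lborel)"
  proof (rule integral_mono)
    show "integrable lborel (\<lambda>x. indicator S x / \<alpha> :: real)" using iS by simp
    show "indicator S x / \<alpha> \<le> indicator S x / h x" for x
    proof (cases "x \<in> S")
      case True
      then have "1 / \<alpha> \<le> 1 / h x"
        using Sh(1,2)[of x] e(1) by (intro frac_le) auto
      with True show ?thesis by simp
    qed simp
  qed (rule fS(2))
  finally have 1: "s / \<alpha> \<le> (\<integral>x. indicator S x / h x \<partial>lborel)" .
  have "(\<integral>x. indicator T x / h x \<partial>lborel) = (\<integral>x. indicator T (a + x) / h (a + x) \<partial>lborel)"
    by (rule integral_lborel_plus[symmetric]) simp
  also have "\<dots> = (\<integral>x. indicator S x / h (a + x) \<partial>lborel)"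
    by (simp add: TS)
  also have "\<dots> \<le> (\<integral>x. indicator S x / \<beta> \<partial>lborel)"
  proof (rule integral_mono')
    show "integrable lborel (\<lambda>x. indicator S x / \<beta> :: real)" using iS by simp
  qed (use Sh e(2) in \<open>auto simp: indicator_def intro!: frac_le\<close>)
  also have "\<dots> = s / \<beta>" by (simp add: s_def)
  finally have 2: "(\<integral>x. indicator T x / h x \<partial>lborel) \<le> s / \<beta>" .
  have "A * (s / \<alpha>) \<le> B * (s / \<beta>)"
    using mult_left_mono[OF 1, of A] le mult_left_mono[OF 2, of B] AB by linarith
  then show ?thesis
    using s \<alpha> e(2) by (simp add: field_simps)
qed

text \<open>A set of positive volume on which \<open>h\<close> lies between \<open>1 / K\<close> and
  \<open>K\<close> serves as reference. Comparing high values of \<open>h\<close> with it through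
  \<open>frame_density_ratio\<close> gives \<open>C\<close>, and comparing low values gives
  \<open>c\<close>.\<close>

lemma frame_density_bounds:
  fixes h :: "'a::euclidean_space \<Rightarrow> real"
  defines "\<mu> \<equiv> density lborel (\<lambda>x. ennreal (h x))"
  assumes h[measurable]: "h \<in> borel_measurable borel" and h0: "\<And>x. 0 \<le> h x"
    and prob: "prob_space \<mu>" and frame: "frame_measure \<mu> \<nu>"
  obtains c C where "0 < c" "0 < C" "AE x in lborel. h x \<le> C" "AE x in lborel. 0 < h x \<longrightarrow> c \<le> h x"
proof -
  interpret prob_space \<mu> by fact
  obtain A B where AB: "0 < A" "0 < B"
    and fr: "\<And>f::'a \<Rightarrow> complex. f \<in> borel_measurable \<mu> \<and> integrable \<mu> (\<lambda>x. (cmod (f x))\<^sup>2) \<Longrightarrow>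
          ennreal (A * (\<integral>x. (cmod (f x))\<^sup>2 \<partial>\<mu>)) \<le> (\<integral>\<^sup>+ t. ennreal ((cmod (fourier_fmu \<mu> f t))\<^sup>2) \<partial>\<nu>) \<and>
          (\<integral>\<^sup>+ t. ennreal ((cmod (fourier_fmu \<mu> f t))\<^sup>2) \<partial>\<nu>) \<le> ennreal (B * (\<integral>x. (cmod (f x))\<^sup>2 \<partial>\<mu>))"
    using frame unfolding frame_measure_def by blast
  have ratio: "A * \<beta> \<le> B * \<alpha>"
    if "0 < e" "0 < \<beta>" "emeasure lborel {x. e \<le> h x \<and> h x \<le> \<alpha>} \<noteq> 0"
       "emeasure lborel {x. \<beta> \<le> h x} \<noteq> 0" for e \<alpha> \<beta>
    using frame_density_ratio[OF h h0 finite_measure_axioms[unfolded \<mu>_def] AB _ _ that, of \<nu>] fr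
    unfolding \<mu>_def by blast
  have nullI: "AE x in lborel. \<not> P x" if "emeasure lborel {x. P x} = 0" "Measurable.pred borel P" for P :: "'a \<Rightarrow> bool"
    using that by (subst AE_iff_measurable[OF _ refl]) auto
  \<comment> \<open>If all these sets were null, \<open>h\<close> would vanish almost everywhere,
    against total mass 1.\<close>
  obtain n where n: "emeasure lborel {x. 1 / real (Suc n) \<le> h x \<and> h x \<le> real (Suc n)} \<noteq> 0"
  proof (rule ccontr)
    assume "\<not> thesis"
    with that have "emeasure lborel {x. 1 / real (Suc n) \<le> h x \<and> h x \<le> real (Suc n)} = 0" for n
      by blast
    then have "AE x in lborel. \<forall>n. \<not> (1 / real (Suc n) \<le> h x \<and> h x \<le> real (Suc n))"
      unfolding AE_all_countable by (intro allI nullI) auto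
    then have "AE x in lborel. h x = 0"
    proof eventually_elim
      case (elim x)
      show ?case
      proof (rule ccontr)
        assume "h x \<noteq> 0"
        with h0[of x] have "0 < h x" by simp
        then obtain n where n: "1 / real (Suc n) < h x"
          using nat_approx_posE by blast
        obtain m :: nat where m: "h x < real m" using reals_Archimedean2 by blast
        have "1 / real (Suc (n + m)) \<le> 1 / real (Suc n)" by (intro frac_le) auto
        with n m elim[rule_format, of "n + m"] show False by simp
      qed
    qed
    then have "emeasure \<mu> (space \<mu>) = 0"
      unfolding \<mu>_def by (subst emeasure_density) (auto simp: nn_integral_0_iff_AE)
    with emeasure_space_1 show False by simp
  qed
  define K where "K = real (Suc n)"
  have K: "0 < K" by (simp add: K_def)
  note n = n[folded K_def]
  \<comment> \<open>The constants are chosen to violate the ratio inequality: \<open>A * C\<close>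
    equals \<open>B * K + A\<close>, and \<open>B * c\<close> is half of
    \<open>A / K\<close>.\<close>
  define C where "C = B * K / A + 1"
  define c where "c = A / (2 * B * K)"
  have C: "0 < C" using AB K by (simp add: C_def add_pos_pos)
  have c: "0 < c" using AB K by (simp add: c_def)
  have "\<not> A * C \<le> B * K"
    using AB by (simp add: C_def distrib_left)
  then have "emeasure lborel {x. C \<le> h x} = 0"
    using ratio[OF _ C n] K by auto
  from nullI[OF this] have up: "AE x in lborel. h x \<le> C" by auto
  have "\<not> A * (1 / K) \<le> B * c"
    using AB K by (simp add: c_def field_simps)
  moreover have "emeasure lborel {x. 1 / K \<le> h x} \<noteq> 0"
  proof
    assume "emeasure lborel {x. 1 / K \<le> h x} = 0"
    then have "emeasure lborel {x. 1 / K \<le> h x \<and> h x \<le> K} = 0"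
      by (rule emeasure_eq_0[rotated]) auto
    with n show False by simp
  qed
  \<comment> \<open>The ratio inequality requires a positive lower cutoff \<open>e\<close>; the
    cutoffs \<open>1 / real (Suc m)\<close> together exhaust the set where \<open>h\<close> is
    positive and at most \<open>c\<close>.\<close>
  ultimately have "emeasure lborel {x. 1 / real (Suc m) \<le> h x \<and> h x \<le> c} = 0" for m
    using ratio[of "1 / real (Suc m)" "1 / K" c] K by auto
  then have "AE x in lborel. \<forall>m. \<not> (1 / real (Suc m) \<le> h x \<and> h x \<le> c)"
    unfolding AE_all_countable by (intro allI nullI) auto
  then have "AE x in lborel. 0 < h x \<longrightarrow> c \<le> h x"
  proof eventually_elim
    case (elim x)
    show ?case
    proof
      assume "0 < h x"
      then obtain m where "1 / real (Suc m) < h x" using nat_approx_posE by blast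
      with elim[rule_format, of m] show "c \<le> h x" by simp
    qed
  qed
  with that c C up show thesis by blast
qed

section \<open>Self-similar measures\<close>

lemma dist_ifs_map:
  assumes "0 < lam" "orthogonal_transformation Orth"
  shows "dist (ifs_map lam Orth b x) (ifs_map lam Orth b y) = lam * dist x y"
proof -
  have "ifs_map lam Orth b x - ifs_map lam Orth b y = lam *\<^sub>R Orth (x - y)"
    using orthogonal_transformation_linear[OF assms(2)]
    by (simp add: ifs_map_def algebra_simps linear_add linear_diff)
  then show ?thesis
    using assms by (simp add: dist_norm orthogonal_transformation_norm)
qed

lemma word_map_Nil: "word_map lam Orth b [] = id"
  and word_map_Cons: "word_map lam Orth b (i # I) = ifs_map lam Orth (b i) \<circ> word_map lam Orth b I"
  by (simp_all add: word_map_def)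

lemma words_0: "words N 0 = {[]}"
  by (auto simp: words_def)

lemma words_Suc: "words N (Suc n) = (\<lambda>(i, I). i # I) ` ({..<N} \<times> words N n)"
  by (auto simp: words_def length_Suc_conv image_iff)

lemma finite_words: "finite (words N n)"
  by (induction n) (simp_all add: words_0 words_Suc)

lemma sum_words_Suc: "(\<Sum>I\<in>words N (Suc n). F I) = (\<Sum>i<N. \<Sum>I\<in>words N n. F (i # I))"
  unfolding words_Suc by (subst sum.reindex) (auto simp: inj_on_def sum.cartesian_product split_def)

lemma dist_word_map:
  assumes "0 < lam" "orthogonal_transformation Orth"
  shows "dist (word_map lam Orth b I x) (word_map lam Orth b I y) = lam ^ length I * dist x y"
  by (induction I) (simp_all add: word_map_Nil word_map_Cons dist_ifs_map[OF assms])

lemma dist_funpow: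
  fixes f :: "'a::metric_space \<Rightarrow> 'a"
  assumes "\<And>x y. dist (f x) (f y) = r * dist x y"
  shows "dist ((f ^^ n) x) ((f ^^ n) y) = r ^ n * dist x y"
  by (induction n) (simp_all add: assms)

text \<open>Otherwise \<open>(a / b) ^ n\<close> would be unbounded. The factor \<open>K\<close>
  does not depend on \<open>n\<close>, so estimates valid up to a constant for all iterates of a map
  yield a sharp inequality.\<close>

lemma le_if_power_le:
  fixes a b K :: real
  assumes "0 < b" "\<And>n::nat. a ^ n \<le> K * b ^ n"
  shows "a \<le> b"
proof (rule ccontr)
  assume "\<not> a \<le> b"
  then have "1 < a / b" using assms(1) by simp
  then obtain n where "K < (a / b) ^ n" using real_arch_pow by blast
  then show False
    using assms(2)[of n] assms(1) by (simp add: power_divide field_simps)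
qed

text \<open>Only the invariance equation and the location of the mass are collected here. The
  density is not fixed: it enters the two weight estimates as an explicit function \<open>h\<close>
  with a one-sided bound.\<close>

locale self_similar =
  fixes lam :: real and Orth :: "'a::euclidean_space \<Rightarrow> 'a"
    and N :: nat and b :: "nat \<Rightarrow> 'a" and p :: "nat \<Rightarrow> real"
    and X :: "'a set" and \<mu> :: "'a measure"
  assumes lam: "0 < lam" "lam < 1"
    and orth: "orthogonal_transformation Orth"
    and p_pos: "\<And>i. i < N \<Longrightarrow> p i > 0"
    and X_compact: "compact X"
    and mu_sets: "sets \<mu> = sets borel"
    and mu_prob: "prob_space \<mu>"
    and mu_inv: "\<And>E. E \<in> sets borel \<Longrightarrow>
                   emeasure \<mu> E = (\<Sum>i<N. ennreal (p i) * emeasure \<mu> (ifs_map lam Orth (b i) -` E))"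
    and mu_X: "emeasure \<mu> (- X) = 0"
begin

abbreviation "\<phi> \<equiv> word_map lam Orth b"
abbreviation "\<A> \<equiv> maps_A lam Orth b N"
abbreviation "w \<equiv> weight_A lam Orth b p N"

sublocale prob_space \<mu> by (rule mu_prob)

lemma X_borel: "X \<in> sets borel"
  using X_compact by (simp add: borel_closed compact_imp_closed)

lemma emeasure_X: "emeasure \<mu> X = 1"
proof -
  have "AE x in \<mu>. x \<in> X"
    using mu_X X_borel mu_sets by (intro AE_I[of _ _ "- X"]) auto
  then show ?thesis
    using emeasure_eq_1_AE[of X] X_borel mu_sets by simp
qed

lemma emeasure_disjoint_X: "E \<inter> X = {} \<Longrightarrow> emeasure \<mu> E = 0"
  using emeasure_eq_0[of "- X" \<mu> E] mu_X X_borel mu_sets by auto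

lemma maps_A_dist:
  assumes "\<tau> \<in> \<A> k"
  shows "dist (\<tau> x) (\<tau> y) = lam ^ k * dist x y"
  using assms dist_word_map[OF lam(1) orth] by (auto simp: maps_A_def words_def)

lemma lam_pow: "0 < lam ^ k"
  using lam by simp

lemma word_weight_pos: "I \<in> words N k \<Longrightarrow> 0 < word_weight p I"
proof -
  have "set I \<subseteq> {..<N} \<Longrightarrow> 0 < word_weight p I"
    by (induction I) (auto simp: word_weight_def p_pos)
  then show "I \<in> words N k \<Longrightarrow> 0 < word_weight p I" by (simp add: words_def)
qed

lemma weight_A_pos:
  assumes "\<tau> \<in> \<A> k"
  shows "0 < w k \<tau>"
  unfolding weight_A_def using assms finite_words
  by (intro sum_pos) (auto simp: maps_A_def word_weight_pos)

section \<open>Cylinder masses from the iterated invariance equation\<close>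

lemma emeasure_words:
  "E \<in> sets borel \<Longrightarrow> emeasure \<mu> E = (\<Sum>I\<in>words N k. ennreal (word_weight p I) * emeasure \<mu> (\<phi> I -` E))"
proof (induction k arbitrary: E)
  case 0
  then show ?case by (simp add: words_0 word_weight_def word_map_Nil)
next
  case (Suc k)
  have vim: "ifs_map lam Orth (b i) -` E \<in> sets borel" for i
    using similarity_measurable[OF lam(1) dist_ifs_map[OF lam(1) orth]] Suc.prems
    by (rule measurable_sets_borel)
  have "emeasure \<mu> E = (\<Sum>i<N. ennreal (p i) * emeasure \<mu> (ifs_map lam Orth (b i) -` E))"
    by (rule mu_inv[OF Suc.prems])
  also have "\<dots> = (\<Sum>i<N. \<Sum>I\<in>words N k. ennreal (word_weight p (i # I)) * emeasure \<mu> (\<phi> (i # I) -` E))"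
  proof (rule sum.cong[OF refl])
    fix i assume "i \<in> {..<N}"
    then have pi: "0 \<le> p i" using p_pos[of i] by simp
    show "ennreal (p i) * emeasure \<mu> (ifs_map lam Orth (b i) -` E)
        = (\<Sum>I\<in>words N k. ennreal (word_weight p (i # I)) * emeasure \<mu> (\<phi> (i # I) -` E))"
      unfolding Suc.IH[OF vim] sum_distrib_left
      by (rule sum.cong[OF refl])
         (use pi in \<open>auto simp: word_weight_def word_map_Cons ennreal_mult' vimage_comp mult.assoc\<close>)
  qed
  also have "\<dots> = (\<Sum>I\<in>words N (Suc k). ennreal (word_weight p I) * emeasure \<mu> (\<phi> I -` E))"
    by (rule sum_words_Suc[symmetric])
  finally show ?case .
qed

text \<open>Isolates what the words representing \<open>\<tau>\<close> contribute to the expansion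
  in \<open>emeasure_words\<close>, so that it can be compared with the full sum.\<close>

lemma weight_A_emeasure:
  "ennreal (w k \<tau>) * emeasure \<mu> (\<tau> -` E)
    = (\<Sum>I\<in>{I \<in> words N k. \<phi> I = \<tau>}. ennreal (word_weight p I) * emeasure \<mu> (\<phi> I -` E))"
proof -
  have "ennreal (w k \<tau>) = (\<Sum>I\<in>{I \<in> words N k. \<phi> I = \<tau>}. ennreal (word_weight p I))"
    unfolding weight_A_def
    by (rule sum_ennreal[symmetric]) (auto intro: less_imp_le word_weight_pos)
  then show ?thesis by (simp add: sum_distrib_right)
qed

lemma emeasure_ge:
  assumes "E \<in> sets borel"
  shows "ennreal (w k \<tau>) * emeasure \<mu> (\<tau> -` E) \<le> emeasure \<mu> E"
  unfolding weight_A_emeasure emeasure_words[OF assms, of k]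
  by (rule sum_mono2) (auto simp: finite_words)

text \<open>For a word with a different map, the preimage of \<open>E\<close> misses
  \<open>X\<close> and is therefore null, so only the words representing \<open>\<tau>\<close>
  contribute.\<close>

lemma emeasure_eq:
  assumes "E \<in> sets borel" "\<And>\<tau>'. \<tau>' \<in> \<A> k \<Longrightarrow> \<tau>' \<noteq> \<tau> \<Longrightarrow> E \<inter> \<tau>' ` X = {}"
  shows "emeasure \<mu> E = ennreal (w k \<tau>) * emeasure \<mu> (\<tau> -` E)"
proof -
  have "emeasure \<mu> (\<phi> I -` E) = 0" if "I \<in> words N k" "\<phi> I \<noteq> \<tau>" for I
    using assms(2)[of "\<phi> I"] that by (intro emeasure_disjoint_X) (auto simp: maps_A_def)
  then show ?thesis
    unfolding weight_A_emeasure emeasure_words[OF assms(1), of k]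
    by (intro sum.mono_neutral_right) (auto simp: finite_words)
qed

lemma emeasure_funpow_ge:
  assumes \<tau>: "\<tau> \<in> \<A> k" and E: "E \<in> sets borel"
  shows "ennreal (w k \<tau> ^ n) * emeasure \<mu> E \<le> emeasure \<mu> ((\<tau> ^^ n) ` E)"
proof (induction n)
  case (Suc n)
  let ?F = "(\<tau> ^^ n) ` E"
  note d = maps_A_dist[OF \<tau>]
  have F: "?F \<in> sets borel"
    by (rule similarity_image_borel[of "(lam ^ k) ^ n"]) (use lam_pow E dist_funpow[OF d] in auto)
  have "ennreal (w k \<tau> ^ Suc n) * emeasure \<mu> E = ennreal (w k \<tau>) * (ennreal (w k \<tau> ^ n) * emeasure \<mu> E)"
    using weight_A_pos[OF \<tau>] by (simp add: ennreal_mult mult.assoc)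
  also have "\<dots> \<le> ennreal (w k \<tau>) * emeasure \<mu> ?F"
    by (rule mult_left_mono[OF Suc]) simp
  also have "\<tau> -` \<tau> ` ?F = ?F"
    by (rule inj_vimage_image_eq[OF bij_is_inj[OF similarity_bij[OF lam_pow d]]])
  then have "ennreal (w k \<tau>) * emeasure \<mu> ?F = ennreal (w k \<tau>) * emeasure \<mu> (\<tau> -` \<tau> ` ?F)"
    by simp
  also have "\<dots> \<le> emeasure \<mu> (\<tau> ` ?F)"
    by (rule emeasure_ge[OF similarity_image_borel[OF lam_pow d F]])
  finally show ?case by (simp add: image_comp)
qed simp

text \<open>Forward invariance keeps all images of \<open>E\<close> inside \<open>U\<close>, away
  from the other cylinders, so \<open>emeasure_eq\<close> applies at every iteration.\<close>

lemma emeasure_funpow_eq: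
  assumes \<tau>: "\<tau> \<in> \<A> k" and E: "E \<in> sets borel" "E \<subseteq> U" and U: "\<tau> ` U \<subseteq> U"
    and disj: "\<And>\<tau>'. \<tau>' \<in> \<A> k \<Longrightarrow> \<tau>' \<noteq> \<tau> \<Longrightarrow> U \<inter> \<tau>' ` X = {}"
  shows "emeasure \<mu> ((\<tau> ^^ n) ` E) = ennreal (w k \<tau> ^ n) * emeasure \<mu> E"
proof -
  note d = maps_A_dist[OF \<tau>]
  have sub: "(\<tau> ^^ n) ` E \<subseteq> U" for n
    by (induction n) (use E U in \<open>auto simp: image_subset_iff\<close>)
  show "emeasure \<mu> ((\<tau> ^^ n) ` E) = ennreal (w k \<tau> ^ n) * emeasure \<mu> E"
  proof (induction n)
    case (Suc n)
    let ?F = "(\<tau> ^^ n) ` E"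
    have F: "?F \<in> sets borel"
      by (rule similarity_image_borel[of "(lam ^ k) ^ n"]) (use lam_pow E dist_funpow[OF d] in auto)
    have "emeasure \<mu> (\<tau> ` ?F) = ennreal (w k \<tau>) * emeasure \<mu> (\<tau> -` \<tau> ` ?F)"
    proof (rule emeasure_eq[OF similarity_image_borel[OF lam_pow d F]])
      fix \<tau>' assume "\<tau>' \<in> \<A> k" "\<tau>' \<noteq> \<tau>"
      from disj[OF this] show "\<tau> ` ?F \<inter> \<tau>' ` X = {}"
        using sub[of "Suc n"] by (auto simp: image_comp)
    qed
    also have "\<tau> -` \<tau> ` ?F = ?F"
      by (rule inj_vimage_image_eq[OF bij_is_inj[OF similarity_bij[OF lam_pow d]]])
    finally show ?case
      using weight_A_pos[OF \<tau>] by (simp add: Suc image_comp ennreal_mult mult.assoc)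
  qed simp
qed

section \<open>Weights compared with the scaling of volume\<close>

text \<open>\<open>X\<close> has full mass and finite volume, so the mass of its \<open>n\<close>-th
  image is at least \<open>w k \<tau> ^ n\<close> and at most \<open>C * measure lborel X\<close>
  times the volume factor. \<open>le_if_power_le\<close> removes the constant.\<close>

lemma weight_A_le:
  fixes h :: "'a \<Rightarrow> real"
  assumes h[measurable]: "h \<in> borel_measurable borel" and \<mu>: "\<mu> = density lborel (\<lambda>x. ennreal (h x))"
    and C: "0 < C" "AE x in lborel. h x \<le> C" and \<tau>: "\<tau> \<in> \<A> k"
  shows "w k \<tau> \<le> lam ^ (DIM('a) * k)"
proof (rule le_if_power_le)
  show "0 < lam ^ (DIM('a) * k)" by (rule lam_pow)
  fix n
  note d = dist_funpow[OF maps_A_dist[OF \<tau>]]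
  have pos: "0 < (lam ^ k) ^ n" using lam by simp
  have XF: "emeasure lborel X < \<infinity>"
    by (rule emeasure_bounded_finite[OF compact_imp_bounded[OF X_compact]])
  have im[measurable]: "(\<tau> ^^ n) ` X \<in> sets borel"
    by (rule similarity_image_borel[OF pos d X_borel])
  have "ennreal (w k \<tau> ^ n) \<le> emeasure \<mu> ((\<tau> ^^ n) ` X)"
    using emeasure_funpow_ge[OF \<tau> X_borel, of n] by (simp add: emeasure_X)
  also have "\<dots> = (\<integral>\<^sup>+x. ennreal (h x) * indicator ((\<tau> ^^ n) ` X) x \<partial>lborel)"
    unfolding \<mu> by (rule emeasure_density) auto
  also have "\<dots> \<le> (\<integral>\<^sup>+x. ennreal C * indicator ((\<tau> ^^ n) ` X) x \<partial>lborel)"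
    by (rule nn_integral_mono_AE, use C(2) in eventually_elim)
       (auto simp: indicator_def intro: ennreal_leI)
  also have "\<dots> = ennreal C * (ennreal (((lam ^ k) ^ n) ^ DIM('a)) * emeasure lborel X)"
    by (simp add: nn_integral_cmult emeasure_lborel_similarity_image[OF pos d X_borel])
  also have "\<dots> = ennreal C * (ennreal (((lam ^ k) ^ n) ^ DIM('a)) * ennreal (measure lborel X))"
    using XF by (simp add: emeasure_eq_ennreal_measure less_top)
  also have "\<dots> = ennreal (C * measure lborel X * (lam ^ (DIM('a) * k)) ^ n)"
    using C(1) lam by (simp add: ennreal_mult[symmetric] power_mult[symmetric] mult_ac)
  finally show "w k \<tau> ^ n \<le> C * measure lborel X * (lam ^ (DIM('a) * k)) ^ n"
    using C(1) lam by (subst (asm) ennreal_le_iff) auto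
qed


text \<open>Two points need care: the neighbourhood of the fixed point must have positive mass, and
  the lower bound \<open>c\<close> holds only where \<open>h\<close> is positive, so the iterates
  must preserve that region up to null sets. Positivity of \<open>k\<close> makes
  \<open>\<tau>\<close> a strict contraction.\<close>

lemma weight_A_ge:
  fixes h :: "'a \<Rightarrow> real"
  assumes h[measurable]: "h \<in> borel_measurable borel" and h0: "\<And>x. 0 \<le> h x"
    and \<mu>: "\<mu> = density lborel (\<lambda>x. ennreal (h x))"
    and c: "0 < c" "AE x in lborel. 0 < h x \<longrightarrow> c \<le> h x"
    and \<tau>: "\<tau> \<in> \<A> k" and k: "0 < k"
    and fpc: "fixed_point_condition lam Orth b N X k \<tau>"
  shows "lam ^ (DIM('a) * k) \<le> w k \<tau>"
proof -
  note d = maps_A_dist[OF \<tau>]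
  note dn = dist_funpow[OF d]
  have pos: "0 < (lam ^ k) ^ n" for n using lam by simp
  have r1: "lam ^ k < 1" using lam k by (simp add: power_less_one_iff)
  define x0 where "x0 = (THE x. \<tau> x = x)"
  have "\<exists>!x. \<tau> x = x"
    by (rule banach_fix_type[of "lam ^ k"]) (use lam r1 d in auto)
  then have x0: "\<tau> x0 = x0"
    unfolding x0_def by (rule theI')
  then have x0n: "(\<tau> ^^ n) x0 = x0" for n
    by (induction n) auto
  \<comment> \<open>The other cylinders are finitely many compact sets, so \<open>L\<close> is
    closed; the fixed point condition puts \<open>x0\<close> outside it, and a whole ball around
    \<open>x0\<close> misses \<open>L\<close>.\<close>
  define L where "L = (\<Union>\<tau>'\<in>\<A> k - {\<tau>}. \<tau>' ` X)"
  have "closed L"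
    unfolding L_def
  proof (intro closed_UN finite_Diff ballI)
    show "finite (\<A> k)" by (simp add: maps_A_def finite_words)
    fix \<tau>' assume "\<tau>' \<in> \<A> k - {\<tau>}"
    then have d': "dist (\<tau>' x) (\<tau>' y) = lam ^ k * dist x y" for x y
      using maps_A_dist by blast
    have "continuous_on X \<tau>'"
      by (rule lipschitz_on_continuous_on[of "lam ^ k"])
         (use lam d' in \<open>auto simp: lipschitz_on_def\<close>)
    with X_compact show "closed (\<tau>' ` X)"
      by (simp add: compact_continuous_image compact_imp_closed)
  qed
  moreover have "x0 \<notin> L"
    using fpc unfolding L_def fixed_point_condition_def x0_def by auto
  ultimately obtain \<delta> where \<delta>: "0 < \<delta>" "ball x0 \<delta> \<subseteq> - L"
    using open_contains_ball[of "- L"] by (auto simp: open_Compl)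
  define U where "U = ball x0 \<delta>"
  have disj: "U \<inter> \<tau>' ` X = {}" if "\<tau>' \<in> \<A> k" "\<tau>' \<noteq> \<tau>" for \<tau>'
    using \<delta>(2) that unfolding U_def L_def by fast
  have U: "\<tau> ` U \<subseteq> U"
  proof
    fix y assume "y \<in> \<tau> ` U"
    then obtain x where x: "y = \<tau> x" "dist x0 x < \<delta>" by (auto simp: U_def)
    have "dist x0 y = lam ^ k * dist x0 x" using d[of x0 x] x0 x(1) by simp
    also have "\<dots> \<le> 1 * dist x0 x" using r1 by (intro mult_right_mono) auto
    finally show "y \<in> U" using x(2) by (simp add: U_def)
  qed
  have [measurable]: "U \<in> sets borel" by (simp add: U_def)
  \<comment> \<open>The images of \<open>X\<close> under the iterates of \<open>\<tau>\<close>
    shrink to \<open>x0\<close>. One of them lies in \<open>U\<close>, and its mass is at least a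
    power of the positive weight.\<close>
  have "emeasure \<mu> U \<noteq> 0"
  proof -
    obtain R where R: "0 < R" "X \<subseteq> ball x0 R"
      using bounded_subset_ballD[OF compact_imp_bounded[OF X_compact]] by blast
    obtain n where n: "(lam ^ k) ^ n < \<delta> / R"
      using real_arch_pow_inv[OF _ r1, of "\<delta> / R"] \<delta> R by auto
    have "(\<tau> ^^ n) ` X \<subseteq> U"
    proof
      fix y assume "y \<in> (\<tau> ^^ n) ` X"
      then obtain x where x: "y = (\<tau> ^^ n) x" "x \<in> X" by auto
      have "dist x0 y = (lam ^ k) ^ n * dist x0 x" using dn[of n x0 x] x0n x(1) by simp
      also have "\<dots> \<le> (lam ^ k) ^ n * R"
        using R x(2) pos[of n] by (intro mult_left_mono) (auto simp: subset_eq less_imp_le)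
      also have "\<dots> < \<delta>" using n R by (simp add: field_simps)
      finally show "y \<in> U" by (simp add: U_def)
    qed
    then have "emeasure \<mu> ((\<tau> ^^ n) ` X) \<le> emeasure \<mu> U"
      using mu_sets by (intro emeasure_mono) (auto simp: U_def)
    moreover have "ennreal (w k \<tau> ^ n) \<le> emeasure \<mu> ((\<tau> ^^ n) ` X)"
      using emeasure_funpow_ge[OF \<tau> X_borel, of n] by (simp add: emeasure_X)
    moreover have "0 < ennreal (w k \<tau> ^ n)" using weight_A_pos[OF \<tau>] by simp
    ultimately have "0 < emeasure \<mu> U" by (meson less_le_trans)
    then show ?thesis by simp
  qed
  define D where "D = {x. 0 < h x}"
  have D[measurable]: "D \<in> sets borel" unfolding D_def by measurable
  define D' where "D' = D \<inter> U"
  have D'[measurable]: "D' \<in> sets borel" by (simp add: D'_def)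
  have em: "emeasure \<mu> E = (\<integral>\<^sup>+x. ennreal (h x) * indicator E x \<partial>lborel)" if "E \<in> sets borel" for E
    unfolding \<mu> using that by (intro emeasure_density) auto
  have mu_D: "emeasure \<mu> (- D) = 0"
  proof -
    have 0: "ennreal (h x) * indicator (- D) x = 0" for x
      by (cases "x \<in> D") (auto simp: D_def ennreal_neg not_less)
    have "- D \<in> sets borel" by simp
    from em[OF this] show ?thesis by (simp only: 0) simp
  qed
  \<comment> \<open>Inside \<open>D\<close> the density is positive, so a set that is null for
    \<open>\<mu>\<close> is also Lebesgue null.\<close>
  have null_D: "emeasure lborel W = 0" if "W \<in> sets borel" "W \<subseteq> D" "emeasure \<mu> W = 0" for W
  proof -
    have [measurable]: "W \<in> sets borel" by fact
    have "AE x in lborel. ennreal (h x) * indicator W x = 0"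
      using that(3) by (subst (asm) em) (auto simp: nn_integral_0_iff_AE)
    then have "AE x in lborel. x \<notin> W"
      by eventually_elim (use that(2) in \<open>auto simp: D_def indicator_def ennreal_eq_0_iff split: if_splits\<close>)
    then show ?thesis by (subst (asm) AE_iff_measurable[OF _ refl]) auto
  qed
  have "emeasure \<mu> U \<le> emeasure \<mu> D' + emeasure \<mu> (- D)"
    using emeasure_subadditive[of D' \<mu> "- D"] emeasure_mono[of U "D' \<union> - D" \<mu>] mu_sets D'_def
    by (auto intro: order_trans)
  with mu_D \<open>emeasure \<mu> U \<noteq> 0\<close> have mu_D': "emeasure \<mu> D' \<noteq> 0" by auto
  have leb_D': "emeasure lborel D' \<noteq> 0"
  proof
    assume "emeasure lborel D' = 0"
    then have "AE x in lborel. x \<notin> D'" by (subst AE_iff_measurable[OF _ refl]) auto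
    then have "AE x in lborel. ennreal (h x) * indicator D' x = 0"
      by eventually_elim auto
    then have "emeasure \<mu> D' = 0" by (subst em) (auto simp: nn_integral_0_iff_AE)
    with mu_D' show False by simp
  qed
  have fin_D': "emeasure lborel D' < \<infinity>"
    by (rule emeasure_bounded_finite) (auto simp: D'_def U_def)
  define s where "s = measure lborel D'"
  have s: "emeasure lborel D' = ennreal s"
    unfolding s_def using fin_D' by (intro emeasure_eq_ennreal_measure) simp
  with leb_D' have s0: "0 < s"
    by (metis ennreal_neg not_less)
  show ?thesis
  proof (rule le_if_power_le)
    show "0 < w k \<tau>" by (rule weight_A_pos[OF \<tau>])
    fix n
    let ?F = "(\<tau> ^^ n) ` D'"
    \<comment> \<open>\<open>W\<close> consists of the points that the iterate moves out of
      \<open>D\<close>. Its image has no mass, the exact scaling then gives \<open>W\<close> no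
      mass, and \<open>null_D\<close> makes \<open>W\<close> and hence its image Lebesgue null. So
      \<open>h\<close> is at least \<open>c\<close> almost everywhere on \<open>?F\<close>.\<close>
    define W where "W = D' \<inter> (\<tau> ^^ n) -` (- D)"
    have F[measurable]: "?F \<in> sets borel"
      by (rule similarity_image_borel[OF pos dn D'])
    have W: "W \<in> sets borel"
      unfolding W_def using similarity_measurable[OF pos dn]
      by (intro sets.Int D' measurable_sets_borel[of _ borel]) auto
    have "emeasure \<mu> ((\<tau> ^^ n) ` W) = 0"
      by (rule emeasure_eq_0[OF _ mu_D]) (use D mu_sets in \<open>auto simp: W_def\<close>)
    then have "emeasure \<mu> W = 0"
      using emeasure_funpow_eq[OF \<tau> W _ U disj, of n] weight_A_pos[OF \<tau>]
      by (auto simp: W_def D'_def)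
    then have "emeasure lborel W = 0"
      by (intro null_D W) (auto simp: W_def D'_def)
    then have "emeasure lborel ((\<tau> ^^ n) ` W) = 0"
      by (simp add: emeasure_lborel_similarity_image[OF pos dn W])
    then have "AE x in lborel. x \<notin> (\<tau> ^^ n) ` W"
      using similarity_image_borel[OF pos dn W] by (intro AE_not_in) (auto simp: null_sets_def)
    then have ae: "AE x in lborel. x \<in> ?F \<longrightarrow> c \<le> h x"
      using c(2)
    proof eventually_elim
      case (elim x)
      then show ?case by (auto simp: W_def D_def)
    qed
    \<comment> \<open>The mass of \<open>?F\<close> is at least \<open>c\<close> times its volume,
      and by exact scaling at most \<open>w k \<tau> ^ n\<close>; the constant passed to
      \<open>le_if_power_le\<close> is \<open>1 / (c * s)\<close>.\<close>
    have "ennreal (c * s * (lam ^ (DIM('a) * k)) ^ n) = ennreal c * emeasure lborel ?F"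
      unfolding emeasure_lborel_similarity_image[OF pos dn D'] s
      using c(1) s0 lam by (simp add: ennreal_mult[symmetric] power_mult[symmetric] mult_ac)
    also have "\<dots> = (\<integral>\<^sup>+x. ennreal c * indicator ?F x \<partial>lborel)"
      by (simp add: nn_integral_cmult)
    also have "\<dots> \<le> (\<integral>\<^sup>+x. ennreal (h x) * indicator ?F x \<partial>lborel)"
      by (rule nn_integral_mono_AE, use ae in eventually_elim)
         (auto simp: indicator_def intro: ennreal_leI)
    also have "\<dots> = emeasure \<mu> ?F"
      by (rule em[OF F, symmetric])
    also have "\<dots> = ennreal (w k \<tau> ^ n) * emeasure \<mu> D'"
      by (rule emeasure_funpow_eq[OF \<tau> D' _ U disj]) (auto simp: D'_def)
    also have "\<dots> \<le> ennreal (w k \<tau> ^ n) * 1"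
      by (intro mult_left_mono) (auto simp: emeasure_le_1)
    finally have "c * s * (lam ^ (DIM('a) * k)) ^ n \<le> w k \<tau> ^ n"
      using weight_A_pos[OF \<tau>] by (simp add: ennreal_le_iff less_imp_le)
    then show "(lam ^ (DIM('a) * k)) ^ n \<le> 1 / (c * s) * w k \<tau> ^ n"
      using c(1) s0 by (simp add: field_simps)
  qed
qed

text \<open>Settles level 0, where the map is the identity, has no unique fixed point and escapes
  the contraction argument.\<close>

lemma weight_A_0:
  assumes "\<tau> \<in> \<A> 0"
  shows "w 0 \<tau> = 1"
proof -
  have "{I \<in> words N 0. \<phi> I = \<tau>} = {[]}"
    using assms by (auto simp: maps_A_def words_0)
  then show ?thesis by (simp add: weight_A_def word_weight_def)
qed

end

section \<open>The Radon-Nikodym density and the final assembly\<close>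

theorem theorem3p10:
  fixes lam :: real and Orth :: "'a::euclidean_space \<Rightarrow> 'a"
    and N :: nat and b :: "nat \<Rightarrow> 'a" and p :: "nat \<Rightarrow> real"
    and X :: "'a set" and \<mu> :: "'a measure"
  assumes lam: "0 < lam" "lam < 1"
    and orth: "orthogonal_transformation Orth"
    and p_pos: "\<And>i. i < N \<Longrightarrow> p i > 0"
    and p_sum: "(\<Sum>i<N. p i) = 1"
    and X_compact: "compact X" and X_ne: "X \<noteq> {}"
    and X_attr: "X = (\<Union>i<N. ifs_map lam Orth (b i) ` X)"
    and mu_sets: "sets \<mu> = sets borel"
    and mu_prob: "prob_space \<mu>"
    and mu_inv: "\<And>E. E \<in> sets borel \<Longrightarrow>
                   emeasure \<mu> E = (\<Sum>i<N. ennreal (p i) * emeasure \<mu> (ifs_map lam Orth (b i) -` E))"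
    and mu_ac: "absolutely_continuous (density lborel (indicator X)) \<mu>"
    and frame: "\<exists>\<nu>. frame_measure \<mu> \<nu>"
  shows "(\<forall>k. \<forall>\<tau>\<in>maps_A lam Orth b N k. weight_A lam Orth b p N k \<tau> \<le> lam ^ (DIM('a) * k))
       \<and> (\<forall>k. \<forall>\<tau>\<in>maps_A lam Orth b N k. fixed_point_condition lam Orth b N X k \<tau> \<longrightarrow>
              weight_A lam Orth b p N k \<tau> = lam ^ (DIM('a) * k))"
proof -
  have ac: "emeasure \<mu> E = 0" if "E \<in> sets borel" "emeasure lborel (E \<inter> X) = 0" for E
  proof -
    have [measurable]: "X \<in> sets borel" "E \<in> sets borel"
      using X_compact that(1) by (simp_all add: borel_closed compact_imp_closed)
    have "emeasure (density lborel (indicator X)) E = (\<integral>\<^sup>+x. indicator X x * indicator E x \<partial>lborel)"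
      by (rule emeasure_density) auto
    also have "\<dots> = (\<integral>\<^sup>+x. indicator (E \<inter> X) x \<partial>lborel)"
      by (intro nn_integral_cong) (auto simp: indicator_def)
    also have "\<dots> = 0" using that(2) by simp
    finally have "E \<in> null_sets (density lborel (indicator X))"
      using that(1) by (auto simp: null_sets_def)
    then have "E \<in> null_sets \<mu>"
      using mu_ac by (auto simp: absolutely_continuous_def)
    then show ?thesis by (simp add: null_sets_def)
  qed
  have mu_X: "emeasure \<mu> (- X) = 0"
    using X_compact by (intro ac) (auto simp: borel_open open_Compl compact_imp_closed)
  interpret self_similar lam Orth N b p X \<mu>
    by (rule self_similar.intro[OF lam orth p_pos X_compact mu_sets mu_prob mu_inv mu_X])
  \<comment> \<open>Passing from Lebesgue measure restricted to \<open>X\<close> to the full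
    Lebesgue measure gives a density defined on the whole space.\<close>
  have ac': "absolutely_continuous lborel \<mu>"
    unfolding absolutely_continuous_def
  proof
    fix E :: "'a set" assume E: "E \<in> null_sets lborel"
    then have "E \<in> sets borel" by auto
    moreover have "emeasure lborel (E \<inter> X) = 0"
      by (rule emeasure_eq_0[of E]) (use E in auto)
    ultimately show "E \<in> null_sets \<mu>"
      using ac mu_sets by (simp add: null_sets_def)
  qed
  have se: "sets \<mu> = sets lborel" using mu_sets by simp
  \<comment> \<open>Finiteness of \<open>\<mu>\<close> permits a real-valued version of the
    derivative, nonnegative at every point as \<open>frame_density_bounds\<close> demands.\<close>
  obtain h where h: "h \<in> borel_measurable lborel"
      "AE x in lborel. RN_deriv lborel \<mu> x = ennreal (h x)" "\<And>x. 0 \<le> h x"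
    using sigma_finite_measure.real_RN_deriv[OF sigma_finite_lborel finite_measure_axioms ac' se] by blast
  have "\<mu> = density lborel (RN_deriv lborel \<mu>)"
    using sigma_finite_measure.density_RN_deriv[OF sigma_finite_lborel ac'] mu_sets by simp
  also have "\<dots> = density lborel (\<lambda>x. ennreal (h x))"
    using h by (intro density_cong) auto
  finally have \<mu>: "\<mu> = density lborel (\<lambda>x. ennreal (h x))" .
  have hb: "h \<in> borel_measurable borel" using h(1) by simp
  obtain \<nu> where "frame_measure \<mu> \<nu>" using frame by blast
  then obtain c C where cC: "0 < c" "0 < C" "AE x in lborel. h x \<le> C"
      "AE x in lborel. 0 < h x \<longrightarrow> c \<le> h x"
    using frame_density_bounds[OF hb h(3)] mu_prob unfolding \<mu> by metis
  have le: "w k \<tau> \<le> lam ^ (DIM('a) * k)" if "\<tau> \<in> \<A> k" for k \<tau>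
    by (rule weight_A_le[OF hb \<mu> cC(2,3) that])
  moreover have "w k \<tau> = lam ^ (DIM('a) * k)"
    if "\<tau> \<in> \<A> k" "fixed_point_condition lam Orth b N X k \<tau>" for k \<tau>
  proof (cases "k = 0")
    case True
    with that show ?thesis by (simp add: weight_A_0)
  next
    case False
    then show ?thesis
      using le[OF that(1)] weight_A_ge[OF hb h(3) \<mu> cC(1,4) that(1) _ that(2)] by simp
  qed
  ultimately show ?thesis by blast
qed

end
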